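(* Let $k\ge 0$ and $d\geq 2k+2$, and let $M\in\mathcal{K}_k(d)$, i.e. $M$ is a connected $d$-dimensional simplicial complex all of whose vertex-links are $k$-stacked homology $(d-1)$-spheres. Let $V(M)$ be the vertex set of $M$, and let $$\overline{M}:=\left\{\alpha\subseteq V(M)\,:\,\text{every subset of }\alpha\text{ of size}\le k+2\text{ is a face of }M\right\}.$$ Then $\overline{M}$ is the unique homology $(d+1)$-manifold (with boundary) such that $\partial\overline{M}=M$ and $\mathrm{skel}_{d-k}(\overline{M})=\mathrm{skel}_{d-k}(M)$.
   Context: Simplicial complexes are finite and contain the empty set as a face. Fix a field $\mathbb{F}$; all homology notions are over $\mathbb{F}$. A homology $d$-sphere is a $d$-dimensional simplicial complex in which the link of every face $\sigma$ (including $\emptyset$, whose link is the whole complex) has the reduced $\mathbb{F}$-homology of a sphere of dimension $d-\dim(\sigma)-1$. A homology $d$-ball is a $d$-dimensional complex $B$ with vanishing reduced $\mathbb{F}$-homology, such that the link of every non-empty face $\sigma$ has the reduced homology of a $(d-\dim(\sigma)-1)$-sphere or of a point, and such that the faces with acyclic link form a homology $(d-1)$-sphere, the boundary $\partial B$ (equivalently, $\partial B$ is the pure subcomplex whose facets are the $(d-1)$-faces lying in exactly one facet of $B$). A homology $d$-manifold is a simplicial complex all of whose vertex-links are homology $(d-1)$-spheres or homology $(d-1)$-balls; its boundary is the pure subcomplex whose facets are the $(d-1)$-faces lying in exactly one facet. $\mathrm{skel}_m(X)$ is the subcomplex of all faces of $X$ of dimension $\le m$. A homology $(e+1)$-ball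 $B$ is $k$-stacked if $\mathrm{skel}_{e-k}(B)=\mathrm{skel}_{e-k}(\partial B)$, i.e. all faces of codimension at least $k+1$ lie in the boundary. A homology $e$-sphere is $k$-stacked if it equals $\partial B$ for some $k$-stacked homology $(e+1)$-ball $B$. *)

theory Defs
  imports Complex_Main "HOL-Library.Function_Algebras"
begin

section \<open>Finite abstract simplicial complexes\<close>

definition simplicial_complex :: "'v set set \<Rightarrow> bool" where
  "simplicial_complex K \<longleftrightarrow>
     finite K \<and> {} \<in> K \<and> (\<forall>\<sigma>\<in>K. finite \<sigma> \<and> (\<forall>\<tau>. \<tau> \<subseteq> \<sigma> \<longrightarrow> \<tau> \<in> K))"

definition vertices :: "'v set set \<Rightarrow> 'v set" where
  "vertices K = \<Union>K"

text \<open>Dimensions are integers, since the empty face has dimension \<open>-1\<close>.\<close>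

definition face_dim :: "'v set \<Rightarrow> int" where
  "face_dim \<sigma> = int (card \<sigma>) - 1"

definition complex_dim :: "'v set set \<Rightarrow> int" where
  "complex_dim K = Max (face_dim ` K)"

definition link :: "'v set set \<Rightarrow> 'v set \<Rightarrow> 'v set set" where
  "link K \<sigma> = {\<tau> \<in> K. \<tau> \<inter> \<sigma> = {} \<and> \<tau> \<union> \<sigma> \<in> K}"

definition skeleton :: "int \<Rightarrow> 'v set set \<Rightarrow> 'v set set" where
  "skeleton m K = {\<sigma> \<in> K. face_dim \<sigma> \<le> m}"

definition facet :: "'v set set \<Rightarrow> 'v set \<Rightarrow> bool" where
  "facet K \<sigma> \<longleftrightarrow> \<sigma> \<in> K \<and> (\<forall>\<tau>\<in>K. \<sigma> \<subseteq> \<tau> \<longrightarrow> \<tau> = \<sigma>)"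

definition connected_complex :: "'v set set \<Rightarrow> bool" where
  "connected_complex K \<longleftrightarrow>
     (\<forall>u\<in>vertices K. \<forall>v\<in>vertices K. (u, v) \<in> {(x, y). {x, y} \<in> K}\<^sup>*)"


section \<open>Reduced simplicial homology over a field\<close>

text \<open>
  An oriented \<open>i\<close>-chain is stored as its coefficient function: \<open>c [x\<^sub>0, \<dots>, x\<^sub>i]\<close> is the
  coefficient of the oriented simplex \<open>[x\<^sub>0, \<dots>, x\<^sub>i]\<close>. It is alternating, hence determined by
  its values on one ordering of every face, and no order on the vertices has to be chosen.
  The empty list represents the empty face, so the chain complex is the augmented one.
\<close>

definition chains :: "'v set set \<Rightarrow> int \<Rightarrow> ('v list \<Rightarrow> 'f::field) set" where
  "chains K i =
     {c. (\<forall>xs. c xs \<noteq> 0 \<longrightarrow> distinct xs \<and> set xs \<in> K \<and> int (length xs) = i + 1) \<and>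
         (\<forall>xs x y ys. c (xs @ x # y # ys) = - c (xs @ y # x # ys))}"

text \<open>
  The usual boundary operator: \<open>\<partial>[v, x\<^sub>0, \<dots>, x\<^sub>i]\<close> contains \<open>[x\<^sub>0, \<dots>, x\<^sub>i]\<close> with
  coefficient \<open>+1\<close>, and every coface of \<open>{x\<^sub>0, \<dots>, x\<^sub>i}\<close> has exactly one such orientation.
\<close>

definition bd :: "'v set set \<Rightarrow> ('v list \<Rightarrow> 'f::field) \<Rightarrow> 'v list \<Rightarrow> 'f" where
  "bd K c = (\<lambda>xs. \<Sum>v\<in>vertices K. c (v # xs))"

definition cycles :: "'v set set \<Rightarrow> int \<Rightarrow> ('v list \<Rightarrow> 'f::field) set" where
  "cycles K i = {c \<in> chains K i. bd K c = 0}"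

definition boundaries :: "'v set set \<Rightarrow> int \<Rightarrow> ('v list \<Rightarrow> 'f::field) set" where
  "boundaries K i = bd K ` chains K (i + 1)"

interpretation chain_space: vector_space "\<lambda>(a::'f::field) (c::'v list \<Rightarrow> 'f) xs. a * c xs"
  by unfold_locales (auto simp: fun_eq_iff algebra_simps)

text \<open>
  The dimension of the homology space \<open>cycles K i / boundaries K i\<close>. For a simplicial complex the
  boundaries form a subspace of the finite-dimensional space of cycles, so the subtraction
  does not truncate. The first argument only carries the type of the coefficient field.
\<close>

definition reduced_betti :: "'f::field itself \<Rightarrow> 'v set set \<Rightarrow> int \<Rightarrow> nat" where
  "reduced_betti F K i =
     chain_space.dim (cycles K i :: ('v list \<Rightarrow> 'f) set)
     - chain_space.dim (boundaries K i :: ('v list \<Rightarrow> 'f) set)"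

definition has_point_homology :: "'f::field itself \<Rightarrow> 'v set set \<Rightarrow> bool" where
  "has_point_homology F K \<longleftrightarrow> (\<forall>i. reduced_betti F K i = 0)"

text \<open>The \<open>(-1)\<close>-sphere is the complex \<open>{{}}\<close>.\<close>

definition has_sphere_homology :: "'f::field itself \<Rightarrow> int \<Rightarrow> 'v set set \<Rightarrow> bool" where
  "has_sphere_homology F n K \<longleftrightarrow> (\<forall>i. reduced_betti F K i = (if i = n then 1 else 0))"


section \<open>Homology spheres, balls and manifolds\<close>

definition homology_sphere :: "'f::field itself \<Rightarrow> int \<Rightarrow> 'v set set \<Rightarrow> bool" where
  "homology_sphere F d K \<longleftrightarrow>
     simplicial_complex K \<and> complex_dim K = d \<and>
     (\<forall>\<sigma>\<in>K. has_sphere_homology F (d - face_dim \<sigma> - 1) (link K \<sigma>))"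

definition ball_boundary :: "'f::field itself \<Rightarrow> 'v set set \<Rightarrow> 'v set set" where
  "ball_boundary F B = {\<sigma> \<in> B. has_point_homology F (link B \<sigma>)}"

definition homology_ball :: "'f::field itself \<Rightarrow> int \<Rightarrow> 'v set set \<Rightarrow> bool" where
  "homology_ball F d B \<longleftrightarrow>
     simplicial_complex B \<and> complex_dim B = d \<and> has_point_homology F B \<and>
     (\<forall>\<sigma>\<in>B. \<sigma> \<noteq> {} \<longrightarrow>
        has_sphere_homology F (d - face_dim \<sigma> - 1) (link B \<sigma>) \<or>
        has_point_homology F (link B \<sigma>)) \<and>
     homology_sphere F (d - 1) (ball_boundary F B)"

definition homology_manifold :: "'f::field itself \<Rightarrow> int \<Rightarrow> 'v set set \<Rightarrow> bool" where
  "homology_manifold F d K \<longleftrightarrow>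
     simplicial_complex K \<and>
     (\<forall>v\<in>vertices K.
        homology_sphere F (d - 1) (link K {v}) \<or> homology_ball F (d - 1) (link K {v}))"

text \<open>
  Boundary of a homology \<open>d\<close>-manifold. It is the void family, not \<open>{{}}\<close>, if no
  \<open>(d-1)\<close>-face lies in exactly one facet.
\<close>

definition manifold_boundary :: "int \<Rightarrow> 'v set set \<Rightarrow> 'v set set" where
  "manifold_boundary d K =
     {\<tau>. \<exists>\<sigma>\<in>K. face_dim \<sigma> = d - 1 \<and> (\<exists>!\<rho>. facet K \<rho> \<and> \<sigma> \<subseteq> \<rho>) \<and> \<tau> \<subseteq> \<sigma>}"


section \<open>Stackedness\<close>

definition stacked_ball :: "'f::field itself \<Rightarrow> nat \<Rightarrow> int \<Rightarrow> 'v set set \<Rightarrow> bool" where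
  "stacked_ball F k n B \<longleftrightarrow>
     homology_ball F n B \<and>
     skeleton (n - 1 - int k) B = skeleton (n - 1 - int k) (ball_boundary F B)"

text \<open>
  The ball is taken over the same vertex type as the sphere. This loses nothing as soon as
  \<open>k \<le> e\<close>, because then all vertices of the ball lie on its boundary.
\<close>

definition stacked_sphere :: "'f::field itself \<Rightarrow> nat \<Rightarrow> int \<Rightarrow> 'v set set \<Rightarrow> bool" where
  "stacked_sphere F k e S \<longleftrightarrow>
     homology_sphere F e S \<and> (\<exists>B. stacked_ball F k (e + 1) B \<and> S = ball_boundary F B)"

text \<open>Membership in the class \<open>\<K>\<^sub>k(d)\<close>.\<close>

definition in_K :: "'f::field itself \<Rightarrow> nat \<Rightarrow> nat \<Rightarrow> 'v set set \<Rightarrow> bool" where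
  "in_K F k d M \<longleftrightarrow>
     simplicial_complex M \<and> connected_complex M \<and> complex_dim M = int d \<and>
     (\<forall>v\<in>vertices M. stacked_sphere F k (int d - 1) (link M {v}))"

definition completion :: "nat \<Rightarrow> 'v set set \<Rightarrow> 'v set set" where
  "completion k M =
     {\<alpha>. \<alpha> \<subseteq> vertices M \<and> (\<forall>\<beta>. \<beta> \<subseteq> \<alpha> \<and> card \<beta> \<le> k + 2 \<longrightarrow> \<beta> \<in> M)}"

text \<open>\<open>N\<close> is a homology \<open>(d+1)\<close>-manifold bounded by \<open>M\<close> with the same \<open>(d-k)\<close>-skeleton as \<open>M\<close>.\<close>

definition stacked_filling ::
    "'f::field itself \<Rightarrow> nat \<Rightarrow> nat \<Rightarrow> 'v set set \<Rightarrow> 'v set set \<Rightarrow> bool" where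
  "stacked_filling F k d M N \<longleftrightarrow>
     homology_manifold F (int d + 1) N \<and>
     manifold_boundary (int d + 1) N = M \<and>
     skeleton (int d - int k) N = skeleton (int d - int k) M"

end

theory Submission
  imports Defs
begin

text \<open>
  The link of \<open>v\<close> in the completion of \<open>M\<close> is the \<open>k\<close>-stacked ball bounded by the link of \<open>v\<close>
  in \<open>M\<close>, and the same holds for every other filling; so the theorem reduces to the fact that a
  \<open>k\<close>-stacked ball \<open>B\<close> is determined by its boundary because it has no missing face with more than
  \<open>k + 1\<close> vertices. A missing face \<open>\<alpha>\<close> with \<open>k + 2\<close> or more vertices would give a nonzero homology
  class in degree at least \<open>k\<close> of the subcomplex induced on \<open>\<alpha>\<close>. There is no such class: the links of
  all faces of \<open>B\<close> of codimension above \<open>k\<close> are acyclic, and this property passes to vertex links,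
  so deleting vertices one at a time never creates homology in degrees at least \<open>k\<close>.
\<close>

section \<open>Chains and boundaries\<close>

lemma chainsD:
  assumes "c \<in> chains K i" "c xs \<noteq> 0"
  shows "distinct xs" "set xs \<in> K" "int (length xs) = i + 1"
  using assms by (auto simp: chains_def)

lemma chains_swap: "c \<in> chains K i \<Longrightarrow> c (xs @ x # y # ys) = - c (xs @ y # x # ys)"
  unfolding chains_def by blast

lemma chainsI:
  assumes "\<And>xs. c xs \<noteq> 0 \<Longrightarrow> distinct xs \<and> set xs \<in> K \<and> int (length xs) = i + 1"
    and "\<And>xs x y ys. c (xs @ x # y # ys) = - c (xs @ y # x # ys)"
  shows "c \<in> chains K i"
  using assms unfolding chains_def by blast

lemma chains_mono: "K \<subseteq> L \<Longrightarrow> chains K i \<subseteq> chains L i"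
  unfolding chains_def by blast

lemma chains_zero [simp]: "0 \<in> chains K i"
  by (auto simp: chains_def)

lemma chains_add:
  assumes "c \<in> chains K i" "d \<in> chains K i"
  shows "c + d \<in> chains K i"
proof (rule chainsI)
  fix xs assume "(c + d) xs \<noteq> 0"
  then have "c xs \<noteq> 0 \<or> d xs \<noteq> 0" by auto
  then show "distinct xs \<and> set xs \<in> K \<and> int (length xs) = i + 1"
    using chainsD[OF assms(1)] chainsD[OF assms(2)] by blast
next
  fix xs x y ys
  show "(c + d) (xs @ x # y # ys) = - (c + d) (xs @ y # x # ys)"
    using chains_swap[OF assms(1), of xs x y ys] chains_swap[OF assms(2), of xs x y ys] by simp
qed

lemma simplicial_complexD:
  assumes "simplicial_complex K"
  shows "finite K" "{} \<in> K" "\<And>\<sigma>. \<sigma> \<in> K \<Longrightarrow> finite \<sigma>" "\<And>\<sigma> \<tau>. \<sigma> \<in> K \<Longrightarrow> \<tau> \<subseteq> \<sigma> \<Longrightarrow> \<tau> \<in> K"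
  using assms by (auto simp: simplicial_complex_def)

lemma finite_vertices: "simplicial_complex K \<Longrightarrow> finite (vertices K)"
  by (auto simp: vertices_def simplicial_complex_def)

lemma vertex_iff: "simplicial_complex K \<Longrightarrow> v \<in> vertices K \<longleftrightarrow> {v} \<in> K"
  unfolding vertices_def by (auto dest: simplicial_complexD(4)[of K _ "{v}"])

lemma face_subset_vertices: "\<sigma> \<in> K \<Longrightarrow> \<sigma> \<subseteq> vertices K"
  by (auto simp: vertices_def)

text \<open>A chain vanishes off the faces of its complex, so extra vertices contribute only zero
  terms. Boundaries in a subcomplex may thus be computed in the ambient complex.\<close>

lemma bd_eq_sum:
  assumes "c \<in> chains K i" "vertices K \<subseteq> V" "finite V"
  shows "bd K c xs = (\<Sum>v\<in>V. c (v # xs))"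
  unfolding bd_def
proof (rule sum.mono_neutral_left)
  show "\<forall>v\<in>V - vertices K. c (v # xs) = 0"
    using chainsD(2)[OF assms(1)] by (force simp: vertices_def)
qed (use assms in auto)

lemma bd_mono:
  assumes "K \<subseteq> L" "finite (vertices L)" "c \<in> chains K i"
  shows "bd K c = bd L c"
proof
  fix xs
  have "vertices K \<subseteq> vertices L" using assms(1) by (auto simp: vertices_def)
  from bd_eq_sum[OF assms(3) this assms(2)] show "bd K c xs = bd L c xs"
    by (simp add: bd_def)
qed

lemma bd_zero [simp]: "bd K 0 = 0"
  by (auto simp: bd_def fun_eq_iff)

lemma bd_add: "bd K (c + d) = bd K c + bd K d"
  by (auto simp: bd_def fun_eq_iff sum.distrib)

lemma bd_scale: "bd K (\<lambda>xs. a * c xs) = (\<lambda>xs. a * bd K c xs)"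
  by (auto simp: bd_def fun_eq_iff sum_distrib_left)

lemma bd_in_chains:
  assumes "simplicial_complex K" "c \<in> chains K (i + 1)"
  shows "bd K c \<in> chains K i"
proof (rule chainsI)
  fix xs assume "bd K c xs \<noteq> 0"
  then obtain v where "c (v # xs) \<noteq> 0"
    unfolding bd_def by (meson sum.not_neutral_contains_not_neutral)
  from chainsD[OF assms(2) this]
  show "distinct xs \<and> set xs \<in> K \<and> int (length xs) = i + 1"
    using simplicial_complexD(4)[OF assms(1), of "set (v # xs)" "set xs"] by auto
next
  fix xs x y ys
  have "c (v # xs @ x # y # ys) = - c (v # xs @ y # x # ys)" for v
    using chains_swap[OF assms(2), of "v # xs" x y ys] by simp
  then show "bd K c (xs @ x # y # ys) = - bd K c (xs @ y # x # ys)"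
    by (simp add: bd_def sum_negf)
qed

text \<open>In characteristic 2 antisymmetry alone would not suffice, hence the hypothesis on the diagonal.\<close>

lemma sum_alternating:
  fixes f :: "'a \<Rightarrow> 'a \<Rightarrow> 'b::ab_group_add"
  assumes "finite V" "\<And>x y. f x y = - f y x" "\<And>x. f x x = 0"
  shows "(\<Sum>x\<in>V. \<Sum>y\<in>V. f x y) = 0"
  using assms(1)
proof (induction V)
  case (insert a V)
  have "(\<Sum>x\<in>V. f x a) = (\<Sum>x\<in>V. - f a x)"
    by (intro sum.cong refl assms(2))
  then show ?case using insert assms(3) by (simp add: sum.distrib sum_negf)
qed simp

lemma bd_bd:
  assumes "simplicial_complex K" "c \<in> chains K i"
  shows "bd K (bd K c) = 0"
proof
  fix xs
  have "c (x # y # xs) = - c (y # x # xs)" for x y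
    using chains_swap[OF assms(2), of "[]" x y xs] by simp
  moreover have "c (x # x # xs) = 0" for x
    using chainsD(1)[OF assms(2), of "x # x # xs"] by auto
  ultimately have "(\<Sum>y\<in>vertices K. \<Sum>x\<in>vertices K. c (x # y # xs)) = 0"
    by (intro sum_alternating finite_vertices[OF assms(1)])
  then show "bd K (bd K c) xs = 0 xs" by (simp add: bd_def)
qed

lemma boundaries_subset_cycles:
  assumes "simplicial_complex K"
  shows "boundaries K i \<subseteq> cycles K i"
  using bd_in_chains[OF assms] bd_bd[OF assms] by (auto simp: boundaries_def cycles_def)

lemma chains_scale: "c \<in> chains K i \<Longrightarrow> (\<lambda>xs. a * c xs) \<in> chains K i"
  by (rule chainsI) (auto dest: chainsD simp del: append_Cons, metis chains_swap mult_minus_right)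

section \<open>Finite dimension and vanishing Betti numbers\<close>

lemma subspace_boundaries: "chain_space.subspace (boundaries K i)"
proof (rule chain_space.subspaceI)
  show "0 \<in> boundaries K i"
    unfolding boundaries_def by (rule image_eqI[of _ _ 0]) auto
qed (auto simp: boundaries_def bd_add[symmetric] bd_scale[symmetric] intro: chains_add chains_scale)

text \<open>The indicators of single lists need not be alternating, hence need not be chains; they
  only form a finite set spanning a larger space.\<close>

lemma chains_finite_dim:
  assumes "simplicial_complex K"
  obtains D where "finite D" "chains K i \<subseteq> chain_space.span D"
proof
  \<comment> \<open>For \<open>i < -1\<close> the truncation \<open>nat (i + 1) = 0\<close> is
    harmless: then no list carries a nonzero coefficient.\<close>
  define L where "L = {xs. set xs \<subseteq> vertices K \<and> length xs = nat (i + 1)}"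
  define e :: "'a list \<Rightarrow> 'a list \<Rightarrow> 'b" where "e = (\<lambda>xs ys. if ys = xs then 1 else 0)"
  have fin: "finite L"
    unfolding L_def by (rule finite_lists_length_eq[OF finite_vertices[OF assms]])
  then show "finite (e ` L)" by simp
  show "chains K i \<subseteq> chain_space.span (e ` L)"
  proof
    fix c :: "'a list \<Rightarrow> 'b" assume c: "c \<in> chains K i"
    have "c = (\<Sum>xs\<in>L. (\<lambda>ys. c xs * e xs ys))"
    proof
      fix ys
      have "(\<Sum>xs\<in>L. (\<lambda>ys. c xs * e xs ys)) ys = (\<Sum>xs\<in>L. c xs * e xs ys)"
        using fin by (induction L) auto
      also have "\<dots> = (\<Sum>xs\<in>L. if xs = ys then c ys else 0)"
        by (rule sum.cong) (auto simp: e_def)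
      also have "\<dots> = (if ys \<in> L then c ys else 0)"
        using fin by simp
      also have "\<dots> = c ys"
        using chainsD[OF c, of ys] face_subset_vertices[of "set ys" K] unfolding L_def by force
      finally show "c ys = (\<Sum>xs\<in>L. (\<lambda>ys. c xs * e xs ys)) ys" by simp
    qed
    moreover have "(\<Sum>xs\<in>L. (\<lambda>ys. c xs * e xs ys)) \<in> chain_space.span (e ` L)"
      by (intro chain_space.span_sum chain_space.span_scale chain_space.span_base imageI)
    ultimately show "c \<in> chain_space.span (e ` L)" by simp
  qed
qed

text \<open>A basis of the boundaries extends to a basis of the cycles. A zero truncated difference
  gives only that the larger basis has no more elements, and finiteness then makes the two
  equal.\<close>

lemma cycles_subset_boundaries:
  fixes F :: "'f::field itself"
  assumes K: "simplicial_complex K" and z: "reduced_betti F K i = 0"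
  shows "cycles K i \<subseteq> (boundaries K i :: ('v list \<Rightarrow> 'f) set)"
proof -
  let ?Z = "cycles K i :: ('v list \<Rightarrow> 'f) set" and ?B = "boundaries K i :: ('v list \<Rightarrow> 'f) set"
  obtain D :: "('v list \<Rightarrow> 'f) set" where D: "finite D" "chains K i \<subseteq> chain_space.span D"
    using chains_finite_dim[OF K] .
  obtain S where S: "S \<subseteq> ?B" "chain_space.independent S" "?B \<subseteq> chain_space.span S"
      "card S = chain_space.dim ?B"
    using chain_space.basis_exists[of ?B] by blast
  obtain T where T: "S \<subseteq> T" "T \<subseteq> ?Z" "chain_space.independent T" "?Z \<subseteq> chain_space.span T"
    using chain_space.maximal_independent_subset_extend[of S ?Z] S boundaries_subset_cycles[OF K]
    by (metis subset_trans)
  have "T \<subseteq> chain_space.span D" using T(2) D(2) by (auto simp: cycles_def)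
  then have finT: "finite T" using chain_space.independent_span_bound[OF D(1) T(3)] by blast
  have "card T = chain_space.dim ?Z"
    by (rule chain_space.basis_card_eq_dim[OF T(2,4,3)])
  then have "card T \<le> card S" using z S(4) by (simp add: reduced_betti_def)
  then have "S = T" by (rule card_seteq[OF finT T(1)])
  then show ?thesis
    using T(4) chain_space.span_minimal[OF S(1) subspace_boundaries] by blast
qed

section \<open>Links and induced subcomplexes\<close>

lemma in_link_vertex_iff:
  "simplicial_complex K \<Longrightarrow> \<tau> \<in> link K {v} \<longleftrightarrow> v \<notin> \<tau> \<and> insert v \<tau> \<in> K"
  using simplicial_complexD(4)[of K "insert v \<tau>" \<tau>] by (auto simp: link_def)

lemma link_empty [simp]: "link K {} = K"
  by (auto simp: link_def)

lemma link_subset: "link K \<sigma> \<subseteq> K"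
  by (auto simp: link_def)

lemma simplicial_complex_link:
  assumes "simplicial_complex K" "\<sigma> \<in> K"
  shows "simplicial_complex (link K \<sigma>)"
proof -
  have "\<tau>' \<in> link K \<sigma>" if "\<tau> \<in> link K \<sigma>" "\<tau>' \<subseteq> \<tau>" for \<tau> \<tau>'
    using that simplicial_complexD(4)[OF assms(1), of "\<tau> \<union> \<sigma>" "\<tau>' \<union> \<sigma>"]
      simplicial_complexD(4)[OF assms(1), of \<tau> \<tau>'] by (auto simp: link_def)
  moreover have "finite (link K \<sigma>)"
    using link_subset simplicial_complexD(1)[OF assms(1)] by (rule finite_subset)
  moreover have "{} \<in> link K \<sigma>"
    using assms simplicial_complexD(2) by (auto simp: link_def)
  ultimately show ?thesis
    using simplicial_complexD(3)[OF assms(1)] link_subset[of K \<sigma>]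
    by (auto simp: simplicial_complex_def)
qed

text \<open>Turns conditions on links inside a vertex link into conditions on links in
  \<open>K\<close> of faces with one more vertex, as induction over vertex links requires.\<close>

lemma link_link_vertex:
  assumes K: "simplicial_complex K" and \<tau>: "\<tau> \<in> link K {v}"
  shows "link (link K {v}) \<tau> = link K (insert v \<tau>)"
proof (rule set_eqI)
  fix \<rho>
  have "\<rho> \<union> \<tau> \<in> link K {v} \<Longrightarrow> \<rho> \<in> link K {v}"
    using K simplicial_complexD(4)[OF K, of "insert v (\<rho> \<union> \<tau>)" "insert v \<rho>"]
    by (auto simp: in_link_vertex_iff)
  then have "\<rho> \<in> link (link K {v}) \<tau> \<longleftrightarrow> \<rho> \<inter> \<tau> = {} \<and> \<rho> \<union> \<tau> \<in> link K {v}"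
    by (auto simp: link_def[of "link K {v}"])
  also have "\<dots> \<longleftrightarrow> \<rho> \<inter> insert v \<tau> = {} \<and> \<rho> \<union> insert v \<tau> \<in> K"
    using \<tau> by (auto simp: in_link_vertex_iff[OF K])
  also have "\<dots> \<longleftrightarrow> \<rho> \<in> link K (insert v \<tau>)"
    using simplicial_complexD(4)[OF K, of "\<rho> \<union> insert v \<tau>" \<rho>] by (auto simp: link_def)
  finally show "\<rho> \<in> link (link K {v}) \<tau> \<longleftrightarrow> \<rho> \<in> link K (insert v \<tau>)" .
qed

section \<open>Induced subcomplexes and deletion of vertices\<close>

lemma simplicial_complex_induced:
  "simplicial_complex K \<Longrightarrow> simplicial_complex (K \<inter> Pow W)"
  by (auto simp: simplicial_complex_def)

lemma link_induced:
  "v \<in> W \<Longrightarrow> link (K \<inter> Pow W) {v} = link K {v} \<inter> Pow W"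
  by (auto simp: link_def)

text \<open>
  A cycle \<open>z\<close> of the deletion of \<open>v\<close> bounds a chain \<open>c0 + v * c1\<close> of \<open>K\<close>. Since \<open>z\<close> avoids \<open>v\<close>,
  \<open>c1\<close> is a cycle of the link of \<open>v\<close>; filling it there replaces \<open>v * c1\<close> by a chain avoiding \<open>v\<close>.
\<close>

lemma vertex_deletion_acyclic:
  fixes j :: int
  assumes K: "simplicial_complex K" and v: "v \<in> vertices K"
    and acK: "cycles K j \<subseteq> (boundaries K j :: ('v list \<Rightarrow> 'f::field) set)"
    and acL: "cycles (link K {v}) j \<subseteq> (boundaries (link K {v}) j :: ('v list \<Rightarrow> 'f) set)"
  shows "cycles (K \<inter> Pow (- {v})) j \<subseteq> (boundaries (K \<inter> Pow (- {v})) j :: ('v list \<Rightarrow> 'f) set)"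
proof
  let ?K' = "K \<inter> Pow (- {v})" and ?L = "link K {v}"
  have LK': "?L \<subseteq> ?K'" by (auto simp: link_def)
  have bdK': "bd ?K' x = bd K x" if "x \<in> chains ?K' i" for i and x :: "'v list \<Rightarrow> 'f"
    using bd_mono[OF _ finite_vertices[OF K] that] by simp
  have bdL: "bd ?L x = bd K x" if "x \<in> chains ?L i" for i and x :: "'v list \<Rightarrow> 'f"
    using bd_mono[OF link_subset finite_vertices[OF K] that] .
  fix z :: "'v list \<Rightarrow> 'f" assume z: "z \<in> cycles ?K' j"
  then have zc: "z \<in> chains ?K' j" by (simp add: cycles_def)
  have zv: "z xs = 0" if "v \<in> set xs" for xs
    using chainsD(2)[OF zc, of xs] that by auto
  have "z \<in> cycles K j"
    using z bdK'[OF zc] chains_mono[of ?K' K j] by (auto simp: cycles_def)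
  then obtain c where c: "c \<in> chains K (j + 1)" and zb: "z = bd K c"
    using acK by (auto simp: boundaries_def)
  define c1 where "c1 = (\<lambda>xs. c (v # xs))"
  define c0 where "c0 = (\<lambda>xs. if v \<in> set xs then 0 else c xs)"
  have c1: "c1 \<in> chains ?L j"
  proof (rule chainsI)
    fix xs assume "c1 xs \<noteq> 0"
    then have "c (v # xs) \<noteq> 0" by (simp add: c1_def)
    from chainsD[OF c this] show "distinct xs \<and> set xs \<in> ?L \<and> int (length xs) = j + 1"
      by (auto simp: in_link_vertex_iff[OF K])
  next
    fix xs x y ys
    show "c1 (xs @ x # y # ys) = - c1 (xs @ y # x # ys)"
      using chains_swap[OF c, of "v # xs" x y ys] by (simp add: c1_def)
  qed
  have c0: "c0 \<in> chains ?K' (j + 1)"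
  proof (rule chainsI)
    fix xs assume "c0 xs \<noteq> 0"
    then have "c xs \<noteq> 0" "v \<notin> set xs" by (auto simp: c0_def split: if_splits)
    with chainsD[OF c this(1)]
    show "distinct xs \<and> set xs \<in> ?K' \<and> int (length xs) = j + 1 + 1" by auto
  next
    fix xs x y ys
    show "c0 (xs @ x # y # ys) = - c0 (xs @ y # x # ys)"
      using chains_swap[OF c, of xs x y ys] by (auto simp: c0_def)
  qed
  \<comment> \<open>Swapping \<open>u\<close> and \<open>v\<close> turns the boundary of
    \<open>c1\<close> at \<open>xs\<close> into minus the coefficient of \<open>z\<close> at
    \<open>v # xs\<close>.\<close>
  have "bd K c1 xs = 0" for xs
  proof -
    have "c (v # u # xs) = - c (u # v # xs)" for u
      using chains_swap[OF c, of "[]" v u xs] by simp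
    then have "bd K c1 xs = (\<Sum>u\<in>vertices K. - c (u # v # xs))"
      unfolding bd_def c1_def by (rule sum.cong[OF refl])
    also have "\<dots> = - z (v # xs)" by (simp add: zb bd_def sum_negf)
    finally show ?thesis by (simp add: zv)
  qed
  then have "c1 \<in> cycles ?L j"
    using c1 bdL[OF c1] by (auto simp: cycles_def fun_eq_iff)
  then obtain e where e: "e \<in> chains ?L (j + 1)" and c1e: "c1 = bd K e"
    using acL bdL by (auto simp: boundaries_def)
  have e': "c0 + e \<in> chains ?K' (j + 1)"
    using chains_add[OF c0] e chains_mono[OF LK'] by blast
  have "z = bd K c0 + c1"
  proof
    fix xs
    show "z xs = (bd K c0 + c1) xs"
    proof (cases "v \<in> set xs")
      case True
      then show ?thesis
        using zv[OF True] chainsD(1)[OF c, of "v # xs"] by (auto simp: bd_def c0_def c1_def)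
    next
      case False
      have "z xs = (\<Sum>u\<in>vertices K. c0 (u # xs) + (if u = v then c (v # xs) else 0))"
        unfolding zb bd_def using False by (intro sum.cong) (auto simp: c0_def)
      also have "\<dots> = bd K c0 xs + c1 xs"
        using v finite_vertices[OF K] by (simp add: sum.distrib bd_def c1_def)
      finally show ?thesis by simp
    qed
  qed
  also have "\<dots> = bd ?K' (c0 + e)"
    unfolding bdK'[OF e'] by (simp only: c1e bd_add)
  finally show "z \<in> boundaries ?K' j"
    using e' by (auto simp: boundaries_def)
qed

text \<open>Acyclicity is kept at the level of chains, the form in which cycles get filled. Degree
  \<open>k\<close> is where the boundary of a simplex with \<open>k + 2\<close> vertices
  lives.\<close>

definition acyclic_from :: "'f::field itself \<Rightarrow> nat \<Rightarrow> 'v set set \<Rightarrow> bool" where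
  "acyclic_from F k K \<longleftrightarrow> (\<forall>j\<ge>int k. cycles K j \<subseteq> (boundaries K j :: ('v list \<Rightarrow> 'f) set))"

lemma point_homology_acyclic_from:
  "simplicial_complex K \<Longrightarrow> has_point_homology F K \<Longrightarrow> acyclic_from F k K"
  using cycles_subset_boundaries[of K F] by (simp add: acyclic_from_def has_point_homology_def)

text \<open>
  Links of vertices satisfy the hypotheses with \<open>m\<close> replaced by \<open>m - 1\<close>, so vertices can be deleted
  one at a time; for \<open>m = 0\<close> the cycles in question are top-dimensional cycles of \<open>K\<close>, hence zero.
\<close>

lemma acyclic_from_induced:
  fixes F :: "'f::field itself" and K :: "'v set set"
  assumes "simplicial_complex K"
    and "\<And>\<sigma>. \<sigma> \<in> K \<Longrightarrow> card \<sigma> \<le> Suc (k + m)"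
    and "\<And>\<sigma>. \<sigma> \<in> K \<Longrightarrow> card \<sigma> \<le> m \<Longrightarrow> acyclic_from F k (link K \<sigma>)"
  shows "acyclic_from F k (K \<inter> Pow W)"
  using assms
proof (induction m arbitrary: K W)
  case 0
  have acK: "acyclic_from F k K"
    using 0(3)[of "{}"] simplicial_complexD(2)[OF 0(1)] by simp
  show ?case
    unfolding acyclic_from_def
  proof (intro allI impI subsetI)
    fix j :: int and z :: "'v list \<Rightarrow> 'f" assume j: "int k \<le> j" and z: "z \<in> cycles (K \<inter> Pow W) j"
    have "z \<in> cycles K j"
      using z bd_mono[OF _ finite_vertices[OF 0(1)], of "K \<inter> Pow W" z j]
        chains_mono[of "K \<inter> Pow W" K j] by (auto simp: cycles_def)
    then obtain c where c: "c \<in> chains K (j + 1)" "z = bd K c"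
      using acK j by (auto simp: acyclic_from_def boundaries_def)
    \<comment> \<open>A nonzero value would need a face with \<open>j + 2\<close>, hence at least
      \<open>k + 2\<close>, vertices, but for \<open>m = 0\<close> faces have at most
      \<open>k + 1\<close>.\<close>
    have "c xs = 0" for xs
    proof (rule ccontr)
      assume "c xs \<noteq> 0"
      from chainsD[OF c(1) this] 0(2)[of "set xs"] j show False
        by (simp add: distinct_card)
    qed
    then have "z = bd (K \<inter> Pow W) 0"
      by (simp add: c(2) bd_def fun_eq_iff)
    then show "z \<in> boundaries (K \<inter> Pow W) j"
      unfolding boundaries_def by (metis chains_zero imageI)
  qed
next
  case (Suc m)
  have *: "acyclic_from F k (K \<inter> Pow (- U))" if "finite U" for U
    using that
  proof (induction U)
    case empty
    then show ?case
      using Suc.prems(3)[of "{}"] simplicial_complexD(2)[OF Suc.prems(1)] by simp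
  next
    case (insert v U)
    let ?K = "K \<inter> Pow (- U)"
    have eq: "K \<inter> Pow (- insert v U) = ?K \<inter> Pow (- {v})" by auto
    have sK: "simplicial_complex ?K" by (rule simplicial_complex_induced[OF Suc.prems(1)])
    show ?case
    proof (cases "v \<in> vertices ?K")
      case False
      then have "?K \<inter> Pow (- {v}) = ?K" by (auto simp: vertices_def)
      then show ?thesis using insert.IH eq by simp
    next
      case True
      then have v: "{v} \<in> K" using vertex_iff[OF sK] by simp
      have "link ?K {v} = link K {v} \<inter> Pow (- U)"
        using insert.hyps by (intro link_induced) simp
      \<comment> \<open>The outer induction hypothesis is applied to the whole link of
        \<open>v\<close> in \<open>K\<close>, because the acyclicity assumption concerns links in
        \<open>K\<close> and not in the deleted complex.\<close>
      moreover have "acyclic_from F k (link K {v} \<inter> Pow (- U))"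
      proof (rule Suc.IH)
        show "simplicial_complex (link K {v})"
          by (rule simplicial_complex_link[OF Suc.prems(1) v])
      next
        fix \<sigma> assume \<sigma>: "\<sigma> \<in> link K {v}"
        have "v \<notin> \<sigma>" and ins: "insert v \<sigma> \<in> K"
          using \<sigma> by (auto simp: in_link_vertex_iff[OF Suc.prems(1)])
        then have cd: "card (insert v \<sigma>) = Suc (card \<sigma>)"
          using simplicial_complexD(3)[OF Suc.prems(1) ins] by simp
        show "card \<sigma> \<le> Suc (k + m)"
          using Suc.prems(2)[OF ins] cd by simp
        assume "card \<sigma> \<le> m"
        then show "acyclic_from F k (link (link K {v}) \<sigma>)"
          unfolding link_link_vertex[OF Suc.prems(1) \<sigma>]
          using Suc.prems(3)[OF ins] cd by simp
      qed
      ultimately show ?thesis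
        using insert.IH unfolding acyclic_from_def eq
        by (intro allI impI vertex_deletion_acyclic[OF sK True]) simp_all
    qed
  qed
  \<comment> \<open>\<open>W\<close> may be arbitrary: only finitely many vertices of
    \<open>K\<close> lie outside it.\<close>
  have "K \<inter> Pow W = K \<inter> Pow (- (vertices K - W))"
    using face_subset_vertices[of _ K] by auto
  with * finite_vertices[OF Suc.prems(1)] show ?case by (metis finite_Diff)
qed

section \<open>Missing faces\<close>

text \<open>For distinct entries with \<open>f\<close> injective on them this is the sign of the
  permutation sorting the list by \<open>f\<close>, as a product over pairs of positions. It orients
  a simplex as an alternating chain.\<close>

primrec order_sign :: "('v \<Rightarrow> nat) \<Rightarrow> 'v list \<Rightarrow> 'f::field" where
  "order_sign f [] = 1"
| "order_sign f (x # xs) = (\<Prod>y\<leftarrow>xs. if f x < f y then 1 else - 1) * order_sign f xs"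

lemma order_sign_swap:
  "f x \<noteq> f y \<Longrightarrow> order_sign f (xs @ x # y # ys) = - order_sign f (xs @ y # x # ys)"
  by (induction xs) (auto simp: algebra_simps)

lemma order_sign_nonzero: "order_sign f xs \<noteq> 0"
  by (induction xs) (auto simp: prod_list_zero_iff)

text \<open>Otherwise the boundary of the full simplex on \<open>\<alpha>\<close> would be a cycle that bounds nothing.\<close>

lemma face_if_boundary_filled:
  fixes F :: "'f::field itself" and K :: "'v set set"
  assumes ac: "acyclic_from F k (K \<inter> Pow \<alpha>)"
    and \<alpha>: "finite \<alpha>" "k + 2 \<le> card \<alpha>" and sub: "\<And>\<beta>. \<beta> \<subset> \<alpha> \<Longrightarrow> \<beta> \<in> K"
  shows "\<alpha> \<in> K"
proof (rule ccontr)
  assume nf: "\<alpha> \<notin> K"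
  let ?K = "K \<inter> Pow \<alpha>" and ?n = "int (card \<alpha>) - 1"
  obtain f :: "'v \<Rightarrow> nat" where f: "inj_on f \<alpha>"
    using finite_imp_inj_to_nat_seg[OF \<alpha>(1)] by blast
  define c :: "'v list \<Rightarrow> 'f"
    where "c = (\<lambda>xs. if distinct xs \<and> set xs = \<alpha> then order_sign f xs else 0)"
  have c: "c \<in> chains (Pow \<alpha>) (?n - 1 + 1)"
  proof (rule chainsI)
    fix xs assume "c xs \<noteq> 0"
    then show "distinct xs \<and> set xs \<in> Pow \<alpha> \<and> int (length xs) = ?n - 1 + 1 + 1"
      using distinct_card[of xs] by (auto simp: c_def split: if_splits)
  next
    fix xs x y ys
    show "c (xs @ x # y # ys) = - c (xs @ y # x # ys)"
    proof (cases "distinct (xs @ x # y # ys) \<and> set (xs @ x # y # ys) = \<alpha>")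
      case True
      then have "f x \<noteq> f y" using f by (auto simp: inj_on_def)
      then show ?thesis using True order_sign_swap[of f x y xs ys] by (auto simp: c_def)
    qed (auto simp: c_def)
  qed
  have full: "simplicial_complex (Pow \<alpha>)"
    using \<alpha>(1) by (auto simp: simplicial_complex_def intro: finite_subset)
  define z where "z = bd (Pow \<alpha>) c"
  have z0: "z \<in> chains (Pow \<alpha>) (?n - 1)"
    unfolding z_def by (rule bd_in_chains[OF full c])
  have z: "z \<in> chains ?K (?n - 1)"
  proof (rule chainsI)
    fix xs assume nz: "z xs \<noteq> 0"
    note * = chainsD[OF z0 nz]
    \<comment> \<open>\<open>z\<close> lives on lists of length \<open>card \<alpha> - 1\<close>, so
      its support consists of proper subsets of \<open>\<alpha>\<close>.\<close>
    have "set xs \<noteq> \<alpha>" using * distinct_card[of xs] by auto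
    then have "set xs \<in> K" using * by (intro sub) auto
    then show "distinct xs \<and> set xs \<in> ?K \<and> int (length xs) = ?n - 1 + 1"
      using * by auto
  qed (rule chains_swap[OF z0])
  have "bd ?K z = bd (Pow \<alpha>) z"
    using bd_mono[OF _ finite_vertices[OF full] z] by simp
  also have "\<dots> = 0"
    unfolding z_def by (rule bd_bd[OF full c])
  finally have "z \<in> cycles ?K (?n - 1)" using z by (simp add: cycles_def)
  moreover have "int k \<le> ?n - 1" using \<alpha>(2) by simp
  ultimately have "z \<in> boundaries ?K (?n - 1)"
    using ac unfolding acyclic_from_def by blast
  then obtain e where e: "e \<in> chains ?K (?n - 1 + 1)" "z = bd ?K e"
    unfolding boundaries_def by blast
  \<comment> \<open>\<open>e\<close> has degree \<open>card \<alpha> - 1\<close>, so it could live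
    only on \<open>\<alpha>\<close> itself, which is not a face by \<open>nf\<close>.\<close>
  have "e xs = 0" for xs
  proof (rule ccontr)
    assume "e xs \<noteq> 0"
    note * = chainsD[OF e(1) this]
    have "set xs = \<alpha>"
      using * distinct_card[of xs] by (intro card_subset_eq[OF \<alpha>(1)]) auto
    with *(2) nf show False by simp
  qed
  then have zz: "z xs = 0" for xs by (simp add: e(2) bd_def)
  obtain ys where ys: "set ys = \<alpha>" "distinct ys"
    using finite_distinct_list[OF \<alpha>(1)] by blast
  then obtain v xs where vxs: "ys = v # xs"
    using \<alpha>(2) by (cases ys) auto
  have "z xs = (\<Sum>u\<in>\<alpha>. c (u # xs))" by (simp add: z_def bd_def vertices_def)
  \<comment> \<open>As \<open>v # xs\<close> lists all of \<open>\<alpha>\<close>, any other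
    \<open>u\<close> repeats an entry of \<open>xs\<close>.\<close>
  also have "\<dots> = (\<Sum>u\<in>\<alpha>. if u = v then c (v # xs) else 0)"
    using ys vxs by (intro sum.cong) (auto simp: c_def)
  also have "\<dots> = order_sign f (v # xs)"
    using \<alpha>(1) ys vxs by (auto simp: c_def)
  finally show False using zz order_sign_nonzero by metis
qed

section \<open>Faces of codimension one\<close>

lemma facet_exists:
  assumes "simplicial_complex K" "\<sigma> \<in> K"
  obtains \<rho> where "facet K \<rho>" "\<sigma> \<subseteq> \<rho>"
  using finite_has_maximal2[OF simplicial_complexD(1)[OF assms(1)] assms(2)]
  unfolding facet_def by metis

lemma face_dim_le_complex_dim:
  "simplicial_complex K \<Longrightarrow> \<sigma> \<in> K \<Longrightarrow> face_dim \<sigma> \<le> complex_dim K"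
  unfolding complex_dim_def by (intro Max_ge) (auto simp: simplicial_complexD(1))

section \<open>Facets, and homology in degrees -1 and 0\<close>

lemma link_facet:
  assumes "facet K \<tau>" "{} \<in> K"
  shows "link K \<tau> = {{}}"
proof -
  have "\<rho> = {}" if "\<rho> \<in> link K \<tau>" for \<rho>
  proof -
    have "\<rho> \<inter> \<tau> = {}" "\<rho> \<union> \<tau> \<in> K" using that by (auto simp: link_def)
    moreover from this(2) have "\<rho> \<union> \<tau> = \<tau>" using assms(1) by (simp add: facet_def)
    ultimately show ?thesis by blast
  qed
  moreover have "{} \<in> link K \<tau>" using assms by (auto simp: link_def facet_def)
  ultimately show ?thesis by blast
qed

text \<open>Without vertices every boundary is zero, whereas the empty face carries a nonzero cycle.
  A facet has link \<open>{{}}\<close>, so this class fixes the size of facets in spheres and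
  balls.\<close>

lemma reduced_betti_empty_complex:
  fixes F :: "'f::field itself"
  shows "reduced_betti F {{} :: 'v set} (- 1) \<noteq> 0"
proof
  assume *: "reduced_betti F {{} :: 'v set} (- 1) = 0"
  define c :: "'v list \<Rightarrow> 'f" where "c = (\<lambda>xs. if xs = [] then 1 else 0)"
  have bd0: "bd {{}} e xs = 0" for e :: "'v list \<Rightarrow> 'f" and xs
    by (simp add: bd_def vertices_def)
  have "c \<in> cycles {{}} (- 1)"
    by (auto simp: cycles_def c_def chains_def bd0 fun_eq_iff)
  then have "c \<in> boundaries {{}} (- 1)"
    using cycles_subset_boundaries[OF _ *] by (auto simp: simplicial_complex_def)
  then have "c [] = 0" by (auto simp: boundaries_def bd0)
  then show False by (simp add: c_def)
qed

text \<open>The complex \<open>{{}}\<close> is excluded by its homology in degree -1. Two vertices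
  would give the cycle \<open>[u] - [w]\<close>, which cannot bound because there are no
  edges.\<close>

lemma point_homology_unique_vertex:
  fixes F :: "'f::field itself" and L :: "'v set set"
  assumes L: "simplicial_complex L" "\<And>\<sigma>. \<sigma> \<in> L \<Longrightarrow> card \<sigma> \<le> 1" and H: "has_point_homology F L"
  shows "\<exists>!u. {u} \<in> L"
proof -
  have "L \<noteq> {{}}"
    using H unfolding has_point_homology_def by (metis reduced_betti_empty_complex)
  then obtain \<tau> where \<tau>: "\<tau> \<in> L" "\<tau> \<noteq> {}" using simplicial_complexD(2)[OF L(1)] by blast
  then obtain u where "u \<in> \<tau>" by blast
  with \<tau> have "{u} \<in> L" using simplicial_complexD(4)[OF L(1)] by auto
  moreover have "u = w" if uw: "{u} \<in> L" "{w} \<in> L" for u w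
  proof (rule ccontr)
    assume ne: "u \<noteq> w"
    define c :: "'v list \<Rightarrow> 'f"
      where "c = (\<lambda>xs. (if xs = [u] then 1 else 0) - (if xs = [w] then 1 else 0))"
    have "c \<in> chains L 0"
      using uw by (intro chainsI) (auto simp: c_def split: if_splits)
    moreover have "bd L c xs = 0" for xs
      using uw finite_vertices[OF L(1)]
      by (cases xs) (auto simp: bd_def c_def sum_subtractf vertex_iff[OF L(1)])
    ultimately have "c \<in> cycles L 0" by (auto simp: cycles_def)
    then have "c \<in> boundaries L 0"
      using cycles_subset_boundaries[OF L(1), of F 0] H by (auto simp: has_point_homology_def)
    then obtain e where e: "e \<in> chains L (0 + 1)" "c = bd L e" by (auto simp: boundaries_def)
    have "e xs = 0" for xs
      using chainsD[OF e(1), of xs] L(2)[of "set xs"] by (fastforce simp: distinct_card)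
    then have "c [u] = 0" by (simp add: e(2) bd_def)
    with ne show False by (simp add: c_def)
  qed
  ultimately show ?thesis by blast
qed

text \<open>With a single vertex the augmentation forces the coefficient of a 0-cycle on it to
  vanish, leaving no class in degree 0.\<close>

lemma zero_sphere_homology_not_unique_vertex:
  fixes F :: "'f::field itself" and L :: "'v set set"
  assumes L: "simplicial_complex L" and H: "has_sphere_homology F 0 L"
  shows "\<not> (\<exists>!u. {u} \<in> L)"
proof
  assume "\<exists>!u. {u} \<in> L"
  then obtain u where u: "\<And>w. {w} \<in> L \<longleftrightarrow> w = u" by metis
  then have V: "vertices L = {u}" using vertex_iff[OF L] by blast
  have "cycles L 0 \<subseteq> {0 :: 'v list \<Rightarrow> 'f}"
  proof
    fix c :: "'v list \<Rightarrow> 'f" assume "c \<in> cycles L 0"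
    then have c: "c \<in> chains L 0" "bd L c = 0" by (auto simp: cycles_def)
    have "c [u] = 0" using fun_cong[OF c(2), of "[]"] by (simp add: bd_def V)
    have "c xs = 0" for xs
    proof (rule ccontr)
      assume "c xs \<noteq> 0"
      from chainsD[OF c(1) this] have "length xs = 1" "set xs \<in> L" by auto
      then have "xs = [u]" by (cases xs) (auto simp: u)
      with \<open>c [u] = 0\<close> \<open>c xs \<noteq> 0\<close> show False by simp
    qed
    then show "c \<in> {0}" by (auto simp: fun_eq_iff)
  qed
  then have "chain_space.dim (cycles L 0 :: ('v list \<Rightarrow> 'f) set) \<le> card ({} :: ('v list \<Rightarrow> 'f) set)"
    by (intro chain_space.dim_le_card) auto
  then have "reduced_betti F L 0 = 0" by (simp add: reduced_betti_def)
  with H show False by (simp add: has_sphere_homology_def)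
qed

text \<open>The facets over \<open>\<sigma>\<close> arise by adding one vertex of its link, so
  counting them becomes counting vertices of the link, which homology can detect.\<close>

lemma unique_facet_iff_unique_vertex:
  assumes K: "simplicial_complex K" and \<sigma>: "\<sigma> \<in> K"
    and pure: "\<And>\<rho>. facet K \<rho> \<Longrightarrow> \<sigma> \<subseteq> \<rho> \<Longrightarrow> card \<rho> = Suc (card \<sigma>)"
  shows "(\<exists>!\<rho>. facet K \<rho> \<and> \<sigma> \<subseteq> \<rho>) \<longleftrightarrow> (\<exists>!u. {u} \<in> link K \<sigma>)"
proof -
  have fin: "finite \<sigma>" using simplicial_complexD(3)[OF K \<sigma>] .
  have lk: "{u} \<in> link K \<sigma> \<longleftrightarrow> u \<notin> \<sigma> \<and> insert u \<sigma> \<in> K" for u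
    using simplicial_complexD(4)[OF K, of "insert u \<sigma>" "{u}"] by (auto simp: link_def)
  have eq: "facet K \<rho> \<and> \<sigma> \<subseteq> \<rho> \<longleftrightarrow> (\<exists>u. {u} \<in> link K \<sigma> \<and> \<rho> = insert u \<sigma>)" for \<rho>
  proof
    assume \<rho>: "facet K \<rho> \<and> \<sigma> \<subseteq> \<rho>"
    then have "\<rho> \<in> K" by (simp add: facet_def)
    have "card (\<rho> - \<sigma>) = 1"
      using pure[of \<rho>] \<rho> fin by (simp add: card_Diff_subset)
    then obtain u where "\<rho> - \<sigma> = {u}" by (rule card_1_singletonE)
    then have "\<rho> = insert u \<sigma>" "u \<notin> \<sigma>" using \<rho> by auto
    with \<open>\<rho> \<in> K\<close> show "\<exists>u. {u} \<in> link K \<sigma> \<and> \<rho> = insert u \<sigma>" by (auto simp: lk)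
  next
    assume "\<exists>u. {u} \<in> link K \<sigma> \<and> \<rho> = insert u \<sigma>"
    then obtain u where u: "u \<notin> \<sigma>" "insert u \<sigma> \<in> K" "\<rho> = insert u \<sigma>" by (auto simp: lk)
    obtain \<rho>' where \<rho>': "facet K \<rho>'" "insert u \<sigma> \<subseteq> \<rho>'" using facet_exists[OF K u(2)] .
    then have "finite \<rho>'" using simplicial_complexD(3)[OF K] by (simp add: facet_def)
    moreover have "card (insert u \<sigma>) = card \<rho>'" using pure[of \<rho>'] \<rho>' u(1) fin by simp
    ultimately have "insert u \<sigma> = \<rho>'" using \<rho>'(2) by (intro card_subset_eq)
    with \<rho>' u show "facet K \<rho> \<and> \<sigma> \<subseteq> \<rho>" by auto
  qed
  show ?thesis
  proof
    assume ex1: "\<exists>!\<rho>. facet K \<rho> \<and> \<sigma> \<subseteq> \<rho>"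
    then obtain \<rho> where \<rho>: "facet K \<rho> \<and> \<sigma> \<subseteq> \<rho>"
      and uniq: "\<And>\<rho>'. facet K \<rho>' \<and> \<sigma> \<subseteq> \<rho>' \<Longrightarrow> \<rho>' = \<rho>"
      by (elim ex1E) metis
    from \<rho> obtain u where u: "{u} \<in> link K \<sigma>" unfolding eq by (elim exE conjE)
    have "w = u" if w: "{w} \<in> link K \<sigma>" for w
    proof -
      have "facet K (insert x \<sigma>) \<and> \<sigma> \<subseteq> insert x \<sigma>" if "{x} \<in> link K \<sigma>" for x
        unfolding eq using that by (intro exI[of _ x] conjI refl)
      from uniq[OF this[OF w]] uniq[OF this[OF u]] have "insert w \<sigma> = insert u \<sigma>" by simp
      then show ?thesis using u w by (auto simp: lk)
    qed
    with u show "\<exists>!u. {u} \<in> link K \<sigma>" by (intro ex1I)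
  next
    assume "\<exists>!u. {u} \<in> link K \<sigma>"
    then obtain u where u: "{u} \<in> link K \<sigma>" and uu: "\<forall>w. {w} \<in> link K \<sigma> \<longrightarrow> w = u"
      by (rule ex1E)
    show "\<exists>!\<rho>. facet K \<rho> \<and> \<sigma> \<subseteq> \<rho>"
    proof (rule ex1I)
      show "facet K (insert u \<sigma>) \<and> \<sigma> \<subseteq> insert u \<sigma>"
        unfolding eq using u by (intro exI[of _ u] conjI refl)
      show "\<rho> = insert u \<sigma>" if "facet K \<rho> \<and> \<sigma> \<subseteq> \<rho>" for \<rho>
        using that uu unfolding eq by blast
    qed
  qed
qed

text \<open>The link of a facet is \<open>{{}}\<close>, whose class in degree -1 must sit in the
  degree prescribed for the sphere.\<close>

lemma homology_sphere_facet_card: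
  fixes S :: "'v set set"
  assumes S: "homology_sphere F e S" and \<tau>: "facet S \<tau>"
  shows "int (card \<tau>) = e + 1"
proof -
  have "{} \<in> S" "\<tau> \<in> S" using S \<tau> by (auto simp: homology_sphere_def simplicial_complex_def facet_def)
  then have "has_sphere_homology F (e - face_dim \<tau> - 1) {{} :: 'v set}"
    using S link_facet[OF \<tau>] unfolding homology_sphere_def by metis
  then have "e - face_dim \<tau> - 1 = - 1"
    unfolding has_sphere_homology_def by (metis reduced_betti_empty_complex)
  then show ?thesis by (simp add: face_dim_def)
qed

lemma homology_ball_links:
  assumes "homology_ball F n B" "\<sigma> \<in> B"
  shows "has_sphere_homology F (n - face_dim \<sigma> - 1) (link B \<sigma>) \<or> has_point_homology F (link B \<sigma>)"
  using assms by (cases "\<sigma> = {}") (auto simp: homology_ball_def)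

text \<open>As for spheres; the acyclic alternative is ruled out because \<open>{{}}\<close> is not
  acyclic.\<close>

lemma homology_ball_facet_card:
  fixes B :: "'v set set"
  assumes B: "homology_ball F n B" and \<tau>: "facet B \<tau>"
  shows "int (card \<tau>) = n + 1"
proof -
  have "{} \<in> B" "\<tau> \<in> B" using B \<tau> by (auto simp: homology_ball_def simplicial_complex_def facet_def)
  then have "has_sphere_homology F (n - face_dim \<tau> - 1) {{} :: 'v set} \<or> has_point_homology F {{} :: 'v set}"
    using homology_ball_links[OF B, of \<tau>] link_facet[OF \<tau>] by auto
  then have "n - face_dim \<tau> - 1 = - 1"
    unfolding has_sphere_homology_def has_point_homology_def by (metis reduced_betti_empty_complex)
  then show ?thesis by (simp add: face_dim_def)
qed

section \<open>Vertex links and the boundary of a manifold\<close>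

context
  fixes F :: "'f::field itself" and N :: "'v set set" and v :: 'v and d :: nat
  assumes N: "simplicial_complex N" and v: "{v} \<in> N"
begin

lemma facet_vertex_link:
  assumes "facet N \<rho>" "v \<in> \<rho>"
  shows "facet (link N {v}) (\<rho> - {v})"
  unfolding facet_def
proof (intro conjI ballI impI)
  show "\<rho> - {v} \<in> link N {v}"
    using assms by (simp add: in_link_vertex_iff[OF N] facet_def insert_absorb)
  fix \<tau> assume "\<tau> \<in> link N {v}" "\<rho> - {v} \<subseteq> \<tau>"
  then have "v \<notin> \<tau>" "insert v \<tau> = \<rho>"
    using assms by (auto simp: in_link_vertex_iff[OF N] facet_def)
  then show "\<tau> = \<rho> - {v}" by auto
qed

text \<open>
  Under the purity hypothesis, the link of a codimension-one face \<open>\<sigma>\<close> consists of isolated vertices,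
  one for each facet containing \<open>\<sigma>\<close>.
\<close>

lemma codim_one_face:
  assumes pure: "\<And>\<rho>. facet (link N {v}) \<rho> \<Longrightarrow> card \<rho> = Suc d"
    and \<sigma>: "\<sigma> \<in> N" "v \<in> \<sigma>" "card \<sigma> = Suc d"
  shows "\<sigma> - {v} \<in> link N {v}" "link (link N {v}) (\<sigma> - {v}) = link N \<sigma>"
    "has_point_homology F (link N \<sigma>) \<Longrightarrow> \<exists>!\<rho>. facet N \<rho> \<and> \<sigma> \<subseteq> \<rho>"
    "has_sphere_homology F 0 (link N \<sigma>) \<Longrightarrow> \<not> (\<exists>!\<rho>. facet N \<rho> \<and> \<sigma> \<subseteq> \<rho>)"
proof -
  show in_lk: "\<sigma> - {v} \<in> link N {v}"
    using \<sigma> by (simp add: in_link_vertex_iff[OF N] insert_absorb)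
  from link_link_vertex[OF N this] show "link (link N {v}) (\<sigma> - {v}) = link N \<sigma>"
    using \<sigma>(2) by (simp add: insert_absorb)
  \<comment> \<open>Purity passes from the vertex link to all facets of \<open>N\<close> over
    \<open>\<sigma>\<close>, since these contain \<open>v\<close>.\<close>
  have fc: "card \<rho> = Suc (card \<sigma>)" if "facet N \<rho>" "\<sigma> \<subseteq> \<rho>" for \<rho>
  proof -
    have "v \<in> \<rho>" "finite \<rho>"
      using that \<sigma>(2) simplicial_complexD(3)[OF N] by (auto simp: facet_def)
    moreover have "card (\<rho> - {v}) = Suc d"
      using pure facet_vertex_link[OF that(1) \<open>v \<in> \<rho>\<close>] by blast
    ultimately show ?thesis using \<sigma>(3) by (simp add: card_Diff_singleton)
  qed
  have L: "simplicial_complex (link N \<sigma>)" by (rule simplicial_complex_link[OF N \<sigma>(1)])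
  have small: "card \<tau> \<le> 1" if "\<tau> \<in> link N \<sigma>" for \<tau>
  proof -
    have \<tau>: "\<tau> \<union> \<sigma> \<in> N" "\<tau> \<inter> \<sigma> = {}" using that by (auto simp: link_def)
    obtain \<rho> where \<rho>: "facet N \<rho>" "\<tau> \<union> \<sigma> \<subseteq> \<rho>" using facet_exists[OF N \<tau>(1)] .
    have "finite \<rho>" using \<rho>(1) simplicial_complexD(3)[OF N] by (auto simp: facet_def)
    then have "card (\<tau> \<union> \<sigma>) \<le> Suc (card \<sigma>)" using card_mono[OF _ \<rho>(2)] fc[OF \<rho>(1)] \<rho>(2) by auto
    then show ?thesis
      using simplicial_complexD(3)[OF N \<tau>(1)] \<tau>(2) by (simp add: card_Un_disjoint)
  qed
  have iff: "(\<exists>!\<rho>. facet N \<rho> \<and> \<sigma> \<subseteq> \<rho>) \<longleftrightarrow> (\<exists>!u. {u} \<in> link N \<sigma>)"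
    by (rule unique_facet_iff_unique_vertex[OF N \<sigma>(1) fc])
  show "\<exists>!\<rho>. facet N \<rho> \<and> \<sigma> \<subseteq> \<rho>" if "has_point_homology F (link N \<sigma>)"
    unfolding iff by (rule point_homology_unique_vertex[OF L small that])
  show "\<not> (\<exists>!\<rho>. facet N \<rho> \<and> \<sigma> \<subseteq> \<rho>)" if "has_sphere_homology F 0 (link N \<sigma>)"
    unfolding iff by (rule zero_sphere_homology_not_unique_vertex[OF L that])
qed

text \<open>The link of \<open>\<sigma>\<close> is also a link in the sphere
  \<open>link N {v}\<close>, so it has the homology of a 0-sphere. This later rules out sphere links
  in a filling at the vertices of \<open>M\<close>.\<close>

lemma not_unique_facet_if_sphere_link:
  assumes S: "homology_sphere F (int d) (link N {v})"
    and \<sigma>: "\<sigma> \<in> N" "v \<in> \<sigma>" "card \<sigma> = Suc d"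
  shows "\<not> (\<exists>!\<rho>. facet N \<rho> \<and> \<sigma> \<subseteq> \<rho>)"
proof -
  have pure: "card \<rho> = Suc d" if "facet (link N {v}) \<rho>" for \<rho>
    using homology_sphere_facet_card[OF S that] by simp
  note cf = codim_one_face[OF pure \<sigma>]
  have "has_sphere_homology F (int d - face_dim (\<sigma> - {v}) - 1) (link N \<sigma>)"
    using S cf(1,2) unfolding homology_sphere_def by metis
  moreover have "int d - face_dim (\<sigma> - {v}) - 1 = 0"
    using \<sigma> simplicial_complexD(3)[OF N \<sigma>(1)] by (simp add: face_dim_def card_Diff_singleton)
  ultimately show ?thesis using cf(4) by simp
qed

text \<open>In a ball the link of \<open>\<sigma>\<close> is acyclic or has the homology of a
  0-sphere, and \<open>codim_one_face\<close> decides each case. So combinatorial and homological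
  boundary agree in codimension one.\<close>

lemma unique_facet_iff_ball_boundary:
  assumes B: "homology_ball F (int d) (link N {v})"
    and \<sigma>: "\<sigma> \<in> N" "v \<in> \<sigma>" "card \<sigma> = Suc d"
  shows "(\<exists>!\<rho>. facet N \<rho> \<and> \<sigma> \<subseteq> \<rho>) \<longleftrightarrow> \<sigma> - {v} \<in> ball_boundary F (link N {v})"
proof -
  have pure: "card \<rho> = Suc d" if "facet (link N {v}) \<rho>" for \<rho>
    using homology_ball_facet_card[OF B that] by simp
  note cf = codim_one_face[OF pure \<sigma>]
  have "has_sphere_homology F (int d - face_dim (\<sigma> - {v}) - 1) (link N \<sigma>)
      \<or> has_point_homology F (link N \<sigma>)"
    using homology_ball_links[OF B cf(1)] cf(2) by simp
  moreover have "int d - face_dim (\<sigma> - {v}) - 1 = 0"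
    using \<sigma> simplicial_complexD(3)[OF N \<sigma>(1)] by (simp add: face_dim_def card_Diff_singleton)
  moreover have "\<sigma> - {v} \<in> ball_boundary F (link N {v}) \<longleftrightarrow> has_point_homology F (link N \<sigma>)"
    using cf(1,2) by (simp add: ball_boundary_def)
  ultimately show ?thesis
    using cf(3,4) by (cases "has_point_homology F (link N \<sigma>)") simp_all
qed

text \<open>Both sides are generated by sets with \<open>d\<close> vertices, the left by
  construction and the right because spheres are pure; on such sets
  \<open>unique_facet_iff_ball_boundary\<close> compares them.\<close>

lemma link_manifold_boundary:
  assumes B: "homology_ball F (int d) (link N {v})"
  shows "link (manifold_boundary (int d + 1) N) {v} = ball_boundary F (link N {v})"
proof (rule set_eqI)
  let ?S = "ball_boundary F (link N {v})" and ?D = "manifold_boundary (int d + 1) N"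
  have S: "homology_sphere F (int d - 1) ?S" using B by (simp add: homology_ball_def)
  then have sS: "simplicial_complex ?S" by (simp add: homology_sphere_def)
  define U where "U \<sigma> \<longleftrightarrow> (\<exists>!\<rho>. facet N \<rho> \<and> \<sigma> \<subseteq> \<rho>)" for \<sigma>
  have U: "U \<sigma> \<longleftrightarrow> \<sigma> - {v} \<in> ?S" if "\<sigma> \<in> N" "v \<in> \<sigma>" "card \<sigma> = Suc d" for \<sigma>
    unfolding U_def by (rule unique_facet_iff_ball_boundary[OF B that])
  have "int (card \<sigma>) - 1 = int d + 1 - 1 \<longleftrightarrow> card \<sigma> = Suc d" for \<sigma> :: "'v set" by auto
  then have D: "\<tau> \<in> ?D \<longleftrightarrow> (\<exists>\<sigma>\<in>N. card \<sigma> = Suc d \<and> U \<sigma> \<and> \<tau> \<subseteq> \<sigma>)" for \<tau>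
    by (simp add: manifold_boundary_def face_dim_def U_def Bex_def)
  fix \<tau>
  have "\<tau> \<in> link ?D {v} \<longleftrightarrow> v \<notin> \<tau> \<and> insert v \<tau> \<in> ?D"
    by (auto simp: link_def D)
  also have "\<dots> \<longleftrightarrow> \<tau> \<in> ?S"
  proof
    assume *: "v \<notin> \<tau> \<and> insert v \<tau> \<in> ?D"
    then obtain \<sigma> where \<sigma>: "\<sigma> \<in> N" "card \<sigma> = Suc d" "U \<sigma>" "insert v \<tau> \<subseteq> \<sigma>"
      unfolding D by blast
    then have "\<sigma> - {v} \<in> ?S" using U by blast
    then show "\<tau> \<in> ?S"
      by (rule simplicial_complexD(4)[OF sS]) (use * \<sigma>(4) in auto)
  next
    assume "\<tau> \<in> ?S"
    then obtain \<rho> where \<rho>: "facet ?S \<rho>" "\<tau> \<subseteq> \<rho>" using facet_exists[OF sS] by blast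
    then have \<rho>S: "\<rho> \<in> ?S" by (simp add: facet_def)
    then have \<rho>N: "v \<notin> \<rho>" "insert v \<rho> \<in> N"
      by (auto simp: ball_boundary_def in_link_vertex_iff[OF N])
    have "card (insert v \<rho>) = Suc d"
      using homology_sphere_facet_card[OF S \<rho>(1)] \<rho>N simplicial_complexD(3)[OF sS \<rho>S] by simp
    moreover from this have "U (insert v \<rho>)" using U[OF \<rho>N(2)] \<rho>S \<rho>N(1) by simp
    ultimately show "v \<notin> \<tau> \<and> insert v \<tau> \<in> ?D"
      using \<rho>N \<rho>(2) unfolding D by blast
  qed
  finally show "\<tau> \<in> link ?D {v} \<longleftrightarrow> \<tau> \<in> ?S" .
qed

end

section \<open>Stacked balls and their fillings\<close>

lemma stacked_ball_low_face:
  assumes "stacked_ball F k n B" "\<sigma> \<in> B" "face_dim \<sigma> \<le> n - 1 - int k"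
  shows "\<sigma> \<in> ball_boundary F B"
proof -
  have "\<sigma> \<in> skeleton (n - 1 - int k) B" using assms(2,3) by (simp add: skeleton_def)
  also have "\<dots> = skeleton (n - 1 - int k) (ball_boundary F B)"
    using assms(1) by (simp add: stacked_ball_def)
  finally show ?thesis by (simp add: skeleton_def)
qed

text \<open>From left to right, \<open>k + 1 <= d - k\<close> puts small subsets of a face into the
  boundary. Conversely, subsets of \<open>\<alpha>\<close> become faces by induction: beyond
  \<open>k + 1\<close> vertices, acyclicity of the induced subcomplex leaves no missing
  face.\<close>

lemma stacked_ball_face_iff:
  assumes B: "stacked_ball F k (int d) B" and kd: "2 * k + 1 \<le> d"
  shows "\<alpha> \<in> B \<longleftrightarrow> \<alpha> \<subseteq> vertices (ball_boundary F B) \<and>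
    (\<forall>\<beta>. \<beta> \<subseteq> \<alpha> \<and> card \<beta> \<le> k + 1 \<longrightarrow> \<beta> \<in> ball_boundary F B)"
proof -
  let ?S = "ball_boundary F B"
  have ball: "homology_ball F (int d) B"
    using B by (simp add: stacked_ball_def)
  have sB: "simplicial_complex B" and dimB: "complex_dim B = int d"
    using ball by (auto simp: homology_ball_def)
  have "simplicial_complex ?S" using ball by (auto simp: homology_ball_def homology_sphere_def)
  have SB: "?S \<subseteq> B" by (auto simp: ball_boundary_def)
  have low: "\<sigma> \<in> ?S" if "\<sigma> \<in> B" "card \<sigma> \<le> d - k" for \<sigma>
    by (rule stacked_ball_low_face[OF B that(1)]) (use that(2) kd in \<open>simp add: face_dim_def\<close>)
  show ?thesis
  proof
    assume \<alpha>: "\<alpha> \<in> B"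
    have "{u} \<in> ?S" if "u \<in> \<alpha>" for u
      using that kd by (intro low simplicial_complexD(4)[OF sB \<alpha>]) auto
    then have "\<alpha> \<subseteq> vertices ?S" by (auto simp: vertices_def)
    moreover have "\<beta> \<in> ?S" if "\<beta> \<subseteq> \<alpha> \<and> card \<beta> \<le> k + 1" for \<beta>
      using that kd by (intro low simplicial_complexD(4)[OF sB \<alpha>]) auto
    ultimately show "\<alpha> \<subseteq> vertices ?S \<and> (\<forall>\<beta>. \<beta> \<subseteq> \<alpha> \<and> card \<beta> \<le> k + 1 \<longrightarrow> \<beta> \<in> ?S)" by blast
  next
    assume \<alpha>: "\<alpha> \<subseteq> vertices ?S \<and> (\<forall>\<beta>. \<beta> \<subseteq> \<alpha> \<and> card \<beta> \<le> k + 1 \<longrightarrow> \<beta> \<in> ?S)"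
    have fin: "finite \<alpha>"
      using \<alpha> finite_vertices[OF \<open>simplicial_complex ?S\<close>] finite_subset by blast
    have "\<beta> \<in> B" if "\<beta> \<subseteq> \<alpha>" for \<beta>
      using finite_subset[OF that fin] that
    proof (induction \<beta> rule: finite_psubset_induct)
      case (psubset \<beta>)
      show ?case
      proof (cases "card \<beta> \<le> k + 1")
        case True
        then show ?thesis using \<alpha> psubset.prems SB by blast
      next
        case False
        \<comment> \<open>With \<open>m = d - k\<close>, faces of \<open>B\<close> have at most
          \<open>d + 1 = Suc (k + m)\<close> vertices, and those with at most \<open>m\<close> lie
          in the boundary, so their links are acyclic.\<close>
        have ac: "acyclic_from F k (B \<inter> Pow \<beta>)"
        proof (rule acyclic_from_induced[OF sB, where m = "d - k"])
          show "card \<sigma> \<le> Suc (k + (d - k))" if "\<sigma> \<in> B" for \<sigma>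
            using face_dim_le_complex_dim[OF sB that] kd unfolding dimB face_dim_def by simp
          show "acyclic_from F k (link B \<sigma>)" if "\<sigma> \<in> B" "card \<sigma> \<le> d - k" for \<sigma>
            using low[OF that]
            by (intro point_homology_acyclic_from simplicial_complex_link[OF sB])
              (auto simp: ball_boundary_def)
        qed
        show ?thesis
        proof (rule face_if_boundary_filled[OF ac psubset.hyps])
          show "k + 2 \<le> card \<beta>" using False by simp
        next
          fix \<gamma> assume "\<gamma> \<subset> \<beta>"
          then show "\<gamma> \<in> B" using psubset.IH psubset.prems by blast
        qed
      qed
    qed
    then show "\<alpha> \<in> B" by blast
  qed
qed

lemma stacked_ball_unique:
  assumes "stacked_ball F k (int d) B" "stacked_ball F k (int d) C" "2 * k + 1 \<le> d"
    and "ball_boundary F B = ball_boundary F C"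
  shows "B = C"
  using stacked_ball_face_iff[OF assms(1,3)] stacked_ball_face_iff[OF assms(2,3)] assms(4) by auto

lemma complex_subset_if_vertex_links_subset:
  assumes dc: "\<And>\<sigma> \<tau>. \<sigma> \<in> K \<Longrightarrow> \<tau> \<subseteq> \<sigma> \<Longrightarrow> \<tau> \<in> K" and L: "{} \<in> L"
    and links: "\<And>v. v \<in> vertices K \<Longrightarrow> link K {v} \<subseteq> link L {v}"
  shows "K \<subseteq> L"
proof
  fix \<sigma> assume \<sigma>: "\<sigma> \<in> K"
  show "\<sigma> \<in> L"
  proof (cases "\<sigma> = {}")
    case False
    then obtain v where v: "v \<in> \<sigma>" by blast
    then have ins: "insert v (\<sigma> - {v}) = \<sigma>" by blast
    then have "\<sigma> - {v} \<in> link K {v}"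
      using \<sigma> dc[OF \<sigma>, of "\<sigma> - {v}"] by (simp add: link_def)
    also have "link K {v} \<subseteq> link L {v}"
      using v \<sigma> by (intro links) (auto simp: vertices_def)
    finally show ?thesis using ins by (simp add: link_def)
  qed (use L in simp)
qed

text \<open>The hypotheses suit \<open>manifold_boundary\<close>, which is not known beforehand to
  be a simplicial complex.\<close>

lemma complex_eq_if_vertex_links_eq:
  assumes "\<And>\<sigma> \<tau>. \<sigma> \<in> K \<Longrightarrow> \<tau> \<subseteq> \<sigma> \<Longrightarrow> \<tau> \<in> K" "\<And>\<sigma> \<tau>. \<sigma> \<in> L \<Longrightarrow> \<tau> \<subseteq> \<sigma> \<Longrightarrow> \<tau> \<in> L"
    and "{} \<in> K" "{} \<in> L"
    and "\<And>v. v \<in> vertices K \<union> vertices L \<Longrightarrow> link K {v} = link L {v}"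
  shows "K = L"
proof
  show "K \<subseteq> L"
    by (rule complex_subset_if_vertex_links_subset[OF assms(1,4)]) (simp_all add: assms(5))
  show "L \<subseteq> K"
    by (rule complex_subset_if_vertex_links_subset[OF assms(2,3)]) (simp_all add: assms(5))
qed

section \<open>The completion is a filling\<close>

context
  fixes F :: "'f::field itself" and M :: "'v set set" and k d :: nat
  assumes kd: "2 * k + 2 \<le> d" and M: "in_K F k d M"
begin

lemma M_complex: "simplicial_complex M"
  using M by (simp add: in_K_def)

lemma vertex_link_ball:
  assumes "v \<in> vertices M"
  obtains B where "stacked_ball F k (int d) B" "link M {v} = ball_boundary F B"
  using M assms by (auto simp: in_K_def stacked_sphere_def)

text \<open>A vertex is what later shows that the manifold boundary of the completion is not
  void.\<close>

lemma vertices_nonempty: "vertices M \<noteq> {}"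
proof
  assume "vertices M = {}"
  then have "M = {{}}" using simplicial_complexD(2)[OF M_complex] by (auto simp: vertices_def)
  moreover have "complex_dim M = int d" using M by (simp add: in_K_def)
  ultimately show False by (simp add: complex_dim_def face_dim_def)
qed

lemma M_subset_completion: "M \<subseteq> completion k M"
  using simplicial_complexD(4)[OF M_complex] face_subset_vertices[of _ M]
  by (auto simp: completion_def)

lemma completion_complex: "simplicial_complex (completion k M)"
proof -
  have "completion k M \<subseteq> Pow (vertices M)" by (auto simp: completion_def)
  then have "finite (completion k M)"
    using finite_vertices[OF M_complex] by (meson finite_Pow_iff finite_subset)
  moreover have "finite \<sigma>" if "\<sigma> \<in> completion k M" for \<sigma>
    using that finite_vertices[OF M_complex] finite_subset by (auto simp: completion_def)
  moreover have "\<tau> \<in> completion k M" if "\<sigma> \<in> completion k M" "\<tau> \<subseteq> \<sigma>" for \<sigma> \<tau>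
    using that unfolding completion_def by blast
  moreover have "{} \<in> completion k M"
    using M_subset_completion simplicial_complexD(2)[OF M_complex] by blast
  ultimately show ?thesis by (auto simp: simplicial_complex_def)
qed

lemma vertices_completion: "vertices (completion k M) = vertices M"
proof
  show "vertices (completion k M) \<subseteq> vertices M"
    unfolding completion_def vertices_def by blast
  show "vertices M \<subseteq> vertices (completion k M)"
    using M_subset_completion by (auto simp: vertices_def)
qed

text \<open>Sets of at most \<open>k + 2\<close> vertices containing \<open>v\<close> correspond to
  sets of at most \<open>k + 1\<close> vertices in the link, which decide membership in
  \<open>B\<close>. Those avoiding \<open>v\<close> impose nothing new: inside a face of
  \<open>B\<close> they are small enough to lie in its boundary, hence in \<open>M\<close>.\<close>

lemma completion_link_ball:
  assumes v: "v \<in> vertices M" and B: "stacked_ball F k (int d) B"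
    and lk: "link M {v} = ball_boundary F B"
  shows "link (completion k M) {v} = B"
proof (rule set_eqI)
  let ?S = "ball_boundary F B"
  have kd': "2 * k + 1 \<le> d" using kd by simp
  note B_iff = stacked_ball_face_iff[OF B kd']
  have S_iff: "\<tau> \<in> ?S \<longleftrightarrow> v \<notin> \<tau> \<and> insert v \<tau> \<in> M" for \<tau>
    unfolding lk[symmetric] by (rule in_link_vertex_iff[OF M_complex])
  have SM: "?S \<subseteq> M" unfolding lk[symmetric] by (rule link_subset)
  have sB: "simplicial_complex B"
    using B by (simp add: stacked_ball_def homology_ball_def)
  fix \<alpha>
  have "\<alpha> \<in> link (completion k M) {v} \<longleftrightarrow> v \<notin> \<alpha> \<and> insert v \<alpha> \<in> completion k M"
    by (rule in_link_vertex_iff[OF completion_complex])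
  also have "\<dots> \<longleftrightarrow> \<alpha> \<in> B"
  proof
    assume \<alpha>: "v \<notin> \<alpha> \<and> insert v \<alpha> \<in> completion k M"
    then have sub: "\<beta> \<in> M" if "\<beta> \<subseteq> insert v \<alpha>" "card \<beta> \<le> k + 2" for \<beta>
      using that by (auto simp: completion_def)
    have "{u} \<in> ?S" if "u \<in> \<alpha>" for u
      unfolding S_iff using that \<alpha> card_insert_le_m1[of 2 "{u}" v] by (auto intro!: sub)
    then have "\<alpha> \<subseteq> vertices ?S" by (auto simp: vertices_def)
    moreover have "\<beta> \<in> ?S" if \<beta>: "\<beta> \<subseteq> \<alpha>" "card \<beta> \<le> k + 1" for \<beta>
    proof -
      have "card (insert v \<beta>) \<le> k + 2" using \<beta>(2) card_insert_le_m1[of "k + 2" \<beta> v] by simp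
      then show ?thesis unfolding S_iff using \<beta>(1) \<alpha> by (auto intro!: sub)
    qed
    ultimately show "\<alpha> \<in> B" unfolding B_iff by blast
  next
    assume \<alpha>: "\<alpha> \<in> B"
    then have \<alpha>S: "\<alpha> \<subseteq> vertices ?S" and low: "\<And>\<beta>. \<beta> \<subseteq> \<alpha> \<Longrightarrow> card \<beta> \<le> k + 1 \<Longrightarrow> \<beta> \<in> ?S"
      unfolding B_iff by blast+
    have "v \<notin> \<alpha>" using \<alpha>S S_iff by (auto simp: vertices_def)
    have "\<beta> \<in> M" if \<beta>: "\<beta> \<subseteq> insert v \<alpha>" "card \<beta> \<le> k + 2" for \<beta>
    proof (cases "v \<in> \<beta>")
      case True
      have "finite \<beta>"
        using simplicial_complexD(3)[OF sB \<alpha>] \<beta>(1) by (meson finite.insertI finite_subset)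
      then have "card (\<beta> - {v}) \<le> k + 1" using \<beta>(2) True by (simp add: card_Diff_singleton)
      then have "\<beta> - {v} \<in> ?S" using \<beta>(1) by (intro low) auto
      then show ?thesis using True by (simp add: S_iff insert_absorb)
    next
      case False
      then have "\<beta> \<in> B" using \<beta>(1) simplicial_complexD(4)[OF sB \<alpha>] by blast
      \<comment> \<open>Up to \<open>k + 2\<close> vertices mean dimension at most
        \<open>k + 1 <= d - 1 - k\<close>; here \<open>2 * k + 2 <= d\<close> enters in
        full.\<close>
      then have "\<beta> \<in> ?S"
        by (rule stacked_ball_low_face[OF B]) (use \<beta>(2) kd in \<open>simp add: face_dim_def\<close>)
      then show ?thesis using SM by blast
    qed
    moreover have "insert v \<alpha> \<subseteq> vertices M"
      using \<alpha>S v SM by (auto simp: vertices_def)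
    ultimately show "v \<notin> \<alpha> \<and> insert v \<alpha> \<in> completion k M"
      using \<open>v \<notin> \<alpha>\<close> by (auto simp: completion_def)
  qed
  finally show "\<alpha> \<in> link (completion k M) {v} \<longleftrightarrow> \<alpha> \<in> B" .
qed

lemma completion_link:
  assumes "v \<in> vertices M"
  shows "stacked_ball F k (int d) (link (completion k M) {v})"
    and "ball_boundary F (link (completion k M) {v}) = link M {v}"
  using vertex_link_ball[OF assms] completion_link_ball[OF assms] by metis+

text \<open>The comparison is made at each vertex: the link of \<open>v\<close> in the manifold
  boundary is the boundary of the ball \<open>link (completion k M) {v}\<close>, which is
  \<open>link M {v}\<close>.\<close>

lemma completion_boundary: "manifold_boundary (int d + 1) (completion k M) = M"
proof -
  let ?D = "manifold_boundary (int d + 1) (completion k M)"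
  have links: "link ?D {v} = link M {v}" if v: "v \<in> vertices M" for v
  proof -
    have "{v} \<in> completion k M"
      using v M_subset_completion vertex_iff[OF M_complex] by blast
    moreover have "homology_ball F (int d) (link (completion k M) {v})"
      using completion_link(1)[OF v] by (simp add: stacked_ball_def)
    ultimately show ?thesis
      using link_manifold_boundary[OF completion_complex] completion_link(2)[OF v] by metis
  qed
  have dc: "\<tau> \<in> ?D" if "\<sigma> \<in> ?D" "\<tau> \<subseteq> \<sigma>" for \<sigma> \<tau>
  proof -
    from that(1) obtain \<rho> where \<rho>: "\<rho> \<in> completion k M" "face_dim \<rho> = int d"
      "\<exists>!\<rho>'. facet (completion k M) \<rho>' \<and> \<rho> \<subseteq> \<rho>'" "\<sigma> \<subseteq> \<rho>"
      by (simp add: manifold_boundary_def Bex_def) (elim exE conjE)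
    moreover have "\<tau> \<subseteq> \<rho>" using that(2) \<rho>(4) by simp
    ultimately show ?thesis
      unfolding manifold_boundary_def mem_Collect_eq by (intro bexI[of _ \<rho>] conjI) simp_all
  qed
  obtain v where v: "v \<in> vertices M" using vertices_nonempty by blast
  have "{} \<in> link ?D {v}"
    unfolding links[OF v] using v vertex_iff[OF M_complex] in_link_vertex_iff[OF M_complex] by simp
  then have "{} \<in> ?D" using link_subset by blast
  have "?D \<subseteq> completion k M"
    using simplicial_complexD(4)[OF completion_complex] by (auto simp: manifold_boundary_def)
  then have "vertices ?D \<subseteq> vertices M"
    unfolding vertices_completion[symmetric] by (auto simp: vertices_def)
  then have lk: "link ?D {v} = link M {v}" if "v \<in> vertices ?D \<union> vertices M" for v
    using that links by blast
  show ?thesis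
  proof (rule complex_eq_if_vertex_links_eq)
    show "\<tau> \<in> M" if "\<sigma> \<in> M" "\<tau> \<subseteq> \<sigma>" for \<sigma> \<tau>
      using that by (rule simplicial_complexD(4)[OF M_complex])
  qed (fact dc \<open>{} \<in> ?D\<close> lk simplicial_complexD(2)[OF M_complex])+
qed

text \<open>Removing a vertex \<open>v\<close> from a face of dimension at most \<open>d - k\<close>
  leaves dimension at most \<open>d - 1 - k\<close>, where stackedness of the link puts it into
  \<open>link M {v}\<close>.\<close>

lemma completion_skeleton:
  "skeleton (int d - int k) (completion k M) = skeleton (int d - int k) M"
proof -
  have "\<sigma> \<in> M" if \<sigma>: "\<sigma> \<in> completion k M" "face_dim \<sigma> \<le> int d - int k" for \<sigma>
  proof (cases "\<sigma> = {}")
    case True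
    then show ?thesis using simplicial_complexD(2)[OF M_complex] by simp
  next
    case False
    then obtain v where v: "v \<in> \<sigma>" by blast
    then have vM: "v \<in> vertices M" using \<sigma>(1) by (auto simp: completion_def)
    have "\<sigma> - {v} \<in> link (completion k M) {v}"
      using v \<sigma>(1) by (simp add: in_link_vertex_iff[OF completion_complex] insert_absorb)
    moreover have "face_dim (\<sigma> - {v}) \<le> int d - 1 - int k"
      using \<sigma>(2) v simplicial_complexD(3)[OF completion_complex \<sigma>(1)] card_gt_0_iff[of \<sigma>]
      by (auto simp: face_dim_def card_Diff_singleton of_nat_diff)
    ultimately have "\<sigma> - {v} \<in> ball_boundary F (link (completion k M) {v})"
      by (rule stacked_ball_low_face[OF completion_link(1)[OF vM]])
    then show ?thesis
      using v unfolding completion_link(2)[OF vM]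
      by (simp add: in_link_vertex_iff[OF M_complex] insert_absorb)
  qed
  then show ?thesis using M_subset_completion by (auto simp: skeleton_def)
qed

lemma completion_filling: "stacked_filling F k d M (completion k M)"
  unfolding stacked_filling_def homology_manifold_def
  using completion_complex completion_boundary completion_skeleton completion_link(1)
  by (auto simp: vertices_completion stacked_ball_def)

section \<open>Uniqueness of the filling\<close>

text \<open>As \<open>v\<close> lies in the boundary \<open>M\<close>, some \<open>d\<close>-face
  through \<open>v\<close> is in exactly one facet, so the link is no sphere and must be a ball. Its
  stackedness is the equality of skeleta, with the bound lowered by one on removing
  \<open>v\<close>.\<close>

lemma filling_link:
  assumes N: "stacked_filling F k d M N" and v: "v \<in> vertices M"
  shows "stacked_ball F k (int d) (link N {v})"
    and "ball_boundary F (link N {v}) = link M {v}"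
proof -
  have sN: "simplicial_complex N" and bdN: "manifold_boundary (int d + 1) N = M"
    and skel: "skeleton (int d - int k) N = skeleton (int d - int k) M"
    using N by (auto simp: stacked_filling_def homology_manifold_def)
  have "{v} \<in> manifold_boundary (int d + 1) N"
    using v vertex_iff[OF M_complex] bdN by simp
  then obtain \<sigma> where \<sigma>: "\<sigma> \<in> N" "face_dim \<sigma> = int d" "\<exists>!\<rho>. facet N \<rho> \<and> \<sigma> \<subseteq> \<rho>" "v \<in> \<sigma>"
    by (simp add: manifold_boundary_def Bex_def) (elim exE conjE)
  then have vN: "{v} \<in> N" "v \<in> vertices N"
    using simplicial_complexD(4)[OF sN \<sigma>(1), of "{v}"] by (auto simp: vertices_def)
  have "card \<sigma> = Suc d" using \<sigma>(2) by (simp add: face_dim_def)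
  then have "\<not> homology_sphere F (int d) (link N {v})"
    using not_unique_facet_if_sphere_link[OF sN vN(1) _ \<sigma>(1,4)] \<sigma>(3) by metis
  then have ball: "homology_ball F (int d) (link N {v})"
    using N vN(2) by (auto simp: stacked_filling_def homology_manifold_def)
  show bdl: "ball_boundary F (link N {v}) = link M {v}"
    using link_manifold_boundary[OF sN vN(1) ball] bdN by simp
  have "\<tau> \<in> link M {v}" if \<tau>: "\<tau> \<in> link N {v}" "face_dim \<tau> \<le> int d - 1 - int k" for \<tau>
  proof -
    have "v \<notin> \<tau>" "insert v \<tau> \<in> N" using \<tau>(1) by (auto simp: in_link_vertex_iff[OF sN])
    moreover have "finite \<tau>"
      using simplicial_complexD(3)[OF sN \<open>insert v \<tau> \<in> N\<close>] by simp
    ultimately have "insert v \<tau> \<in> skeleton (int d - int k) N"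
      using \<tau>(2) by (simp add: skeleton_def face_dim_def)
    then have "insert v \<tau> \<in> M" unfolding skel by (simp add: skeleton_def)
    with \<open>v \<notin> \<tau>\<close> show ?thesis by (simp add: in_link_vertex_iff[OF M_complex])
  qed
  then have "skeleton (int d - 1 - int k) (link N {v})
      = skeleton (int d - 1 - int k) (ball_boundary F (link N {v}))"
    unfolding skeleton_def bdl by (auto simp: bdl[symmetric] ball_boundary_def)
  with ball show "stacked_ball F k (int d) (link N {v})" by (simp add: stacked_ball_def)
qed

text \<open>At each vertex both fillings have as link a \<open>k\<close>-stacked ball with boundary
  \<open>link M {v}\<close>, and such a ball is unique.\<close>

lemma filling_unique:
  assumes N: "stacked_filling F k d M N"
  shows "N = completion k M"
proof (rule complex_eq_if_vertex_links_eq)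
  have sN: "simplicial_complex N" and skel: "skeleton (int d - int k) N = skeleton (int d - int k) M"
    using N by (auto simp: stacked_filling_def homology_manifold_def)
  have VN: "vertices N \<subseteq> vertices M"
  proof
    fix v assume "v \<in> vertices N"
    \<comment> \<open>As \<open>d - k >= 0\<close>, the skeleton contains all vertices, so a filling
      has none outside \<open>M\<close>.\<close>
    then have "{v} \<in> skeleton (int d - int k) N"
      using kd by (simp add: vertex_iff[OF sN] skeleton_def face_dim_def)
    then show "v \<in> vertices M"
      unfolding skel by (simp add: vertex_iff[OF M_complex] skeleton_def)
  qed
  show "link N {v} = link (completion k M) {v}" if "v \<in> vertices N \<union> vertices (completion k M)" for v
  proof -
    have v: "v \<in> vertices M" using that VN vertices_completion by blast
    show ?thesis
      by (rule stacked_ball_unique[OF filling_link(1)[OF N v] completion_link(1)[OF v]])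
        (use kd filling_link(2)[OF N v] completion_link(2)[OF v] in simp_all)
  qed
qed (use N completion_complex in \<open>auto simp: stacked_filling_def homology_manifold_def
      simplicial_complex_def\<close>)

end

theorem theorem2p20:
  fixes F :: "'f::field itself" and M :: "'v set set" and k d :: nat
  assumes "2 * k + 2 \<le> d"
    and "in_K F k d M"
  shows "stacked_filling F k d M (completion k M) \<and>
         (\<forall>N. stacked_filling F k d M N \<longrightarrow> N = completion k M)"
  using completion_filling[OF assms] filling_unique[OF assms] by blast

end
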